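(* Let $S$ be a compact cancellative topological monoid with open shifts. Then $S$ has countable cellularity.
   Context: A topological monoid is a monoid $S$ with a topology for which the operation $S\times S\to S$ is continuous. It has open shifts if for every $a\in S$ and every open $U\subseteq S$ the sets $aU$ and $Ua$ are open in $S$. Cancellative means that each of $ax=ay$ and $xa=ya$ implies $x=y$. No separation axiom is assumed; in particular compact means only that every open cover has a finite subcover. A cellular family in a space $X$ is a nonempty family of pairwise disjoint nonempty open subsets of $X$; the cellularity is $c(X)=\sup\{|\mathcal{U}|:\mathcal{U}\text{ a cellular family in }X\}+\aleph_0$, and $X$ has countable cellularity (the Souslin property) if $c(X)=\aleph_0$. *)

theory Defs
  imports "HOL-Analysis.Product_Topology" "HOL-Algebra.Coset" "HOL-Algebra.Divisibility"
begin

unbundle cardinal_syntax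

locale topological_monoid = monoid S
  for S :: "('a, 'b) monoid_scheme" (structure) and T :: "'a topology" +
  assumes topspace_eq: "topspace T = carrier S"
    and continuous_mult: "continuous_map (prod_topology T T) T (\<lambda>(x, y). x \<otimes> y)"

definition open_shifts :: "('a, 'b) monoid_scheme \<Rightarrow> 'a topology \<Rightarrow> bool" where
  "open_shifts S T \<longleftrightarrow>
     (\<forall>a\<in>carrier S. \<forall>U. openin T U \<longrightarrow>
        openin T (a <#\<^bsub>S\<^esub> U) \<and> openin T (U #>\<^bsub>S\<^esub> a))"

definition cellular_family :: "'a topology \<Rightarrow> 'a set set \<Rightarrow> bool" where
  "cellular_family X \<U> \<longleftrightarrow>
     \<U> \<noteq> {} \<and> (\<forall>U\<in>\<U>. openin X U \<and> U \<noteq> {}) \<and> pairwise disjnt \<U>"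

text \<open>Cardinals are wellorders with \<^const>\<open>Card_order\<close>, determined up to order isomorphism.
  The supremum of a set of cardinals is its least upper bound, a representative of which is
  chosen on the same type; the two facts below show that it always exists there
  and that it is least among the upper bounds on any type.\<close>

definition is_card_Sup :: "'b rel set \<Rightarrow> 'b rel \<Rightarrow> bool" where
  "is_card_Sup R s \<longleftrightarrow>
     Card_order s \<and> (\<forall>r\<in>R. r \<le>o s) \<and>
     (\<forall>s' :: 'b rel. Card_order s' \<and> (\<forall>r\<in>R. r \<le>o s') \<longrightarrow> s \<le>o s')"

definition card_Sup :: "'b rel set \<Rightarrow> 'b rel" where
  "card_Sup R = (SOME s. is_card_Sup R s)"

lemma is_card_Sup_card_Sup:
  fixes R :: "'b rel set"
  assumes "\<And>r. r \<in> R \<Longrightarrow> Card_order r"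
  shows "is_card_Sup R (card_Sup R)"
proof -
  let ?B = "{s :: 'b rel. Card_order s \<and> (\<forall>r\<in>R. r \<le>o s)}"
  have "r \<le>o |UNIV :: 'b set|" if "r \<in> R" for r
    using card_of_mono1[OF subset_UNIV, of "Field r"] card_of_Field_ordIso[OF assms[OF that]]
      ordIso_ordLeq_trans ordIso_symmetric by blast
  then have "|UNIV :: 'b set| \<in> ?B"
    by (simp add: card_of_Card_order)
  then have "?B \<noteq> {}" by blast
  moreover have "\<forall>s\<in>?B. Card_order s" by blast
  ultimately obtain s where "s \<in> ?B" "\<forall>s'\<in>?B. s \<le>o s'"
    using exists_minim_Card_order[of ?B] by blast
  then have "is_card_Sup R s"
    by (simp add: is_card_Sup_def)
  then show ?thesis
    unfolding card_Sup_def by (rule someI)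
qed

lemma card_Sup_least:
  fixes R :: "'b rel set" and t :: "'c rel"
  assumes "\<And>r. r \<in> R \<Longrightarrow> Card_order r"
    and t: "Card_order t" "\<And>r. r \<in> R \<Longrightarrow> r \<le>o t"
  shows "card_Sup R \<le>o t"
proof (rule ccontr)
  let ?s = "card_Sup R"
  have s: "is_card_Sup R ?s"
    using assms(1) by (rule is_card_Sup_card_Sup)
  then have cs: "Card_order ?s"
    by (simp add: is_card_Sup_def)
  assume neg: "\<not> ?s \<le>o t"
  then have "t \<le>o ?s"
    using cs t(1) by (meson card_order_on_well_order_on ordLeq_total)
  then have "|Field t| \<le>o |Field ?s|"
    using card_of_mono2 by blast
  then obtain f where f: "inj_on f (Field t)" "f ` Field t \<subseteq> Field ?s"
    using card_of_ordLeq by metis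
  have "|Field t| =o |f ` Field t|"
    using card_of_ordIso[of "Field t" "f ` Field t"] inj_on_imp_bij_betw[OF f(1)] by blast
  then have eq: "t =o |f ` Field t|"
    using card_of_Field_ordIso[OF t(1)] ordIso_symmetric ordIso_transitive by blast
  then have "r \<le>o |f ` Field t|" if "r \<in> R" for r
    using t(2)[OF that] ordLeq_ordIso_trans by blast
  then have "?s \<le>o |f ` Field t|"
    using s card_of_Card_order unfolding is_card_Sup_def by blast
  then show False
    using neg eq ordIso_symmetric ordLeq_ordIso_trans by blast
qed

definition cellularity :: "'a topology \<Rightarrow> ('a set + nat) rel" where
  "cellularity X = card_Sup {|\<U>| | \<U>. cellular_family X \<U>} +c natLeq"

definition countable_cellularity :: "'a topology \<Rightarrow> bool" where
  "countable_cellularity X \<longleftrightarrow> cellularity X =o natLeq"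

end

theory Submission
  imports Defs "HOL-Library.Countable_Set_Type"
begin

text \<open>There are no inverses and there is no Haar measure, but two substitutes suffice.
  First, every closed subsemigroup contains the unit, so some power \<open>a\<^sup>k\<close> with \<open>k > 0\<close> lies in any
  given neighbourhood of the unit and \<open>a\<^sup>k\<^sup>-\<^sup>1\<close> acts as an approximate inverse of \<open>a\<close>.
  Second, translates \<open>xV\<close> and \<open>yV\<close> meet as soon as \<open>x\<close> and \<open>y\<close> are close enough to the unit.
  The counting measure on a finite set \<open>E\<close> of maximal size with pairwise disjoint translates
  \<open>eW\<close> is then almost invariant under left translation. If \<open>n\<close> translates of \<open>V\<close> cover the monoid,
  then a slight enlargement of any translate \<open>xV\<close> carries at least the fraction \<open>1/n\<close> of \<open>E\<close>, so
  at most \<open>n\<close> members of a cellular family contain a translate of such a \<open>V\<close> with room to spare.\<close>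

locale compact_cancel_monoid = topological_monoid S T + monoid_cancel S
  for S :: "('a, 'b) monoid_scheme" (structure) and T :: "'a topology" +
  assumes shifts: "open_shifts S T"
    and compact: "compact_space T"
begin

section \<open>Neighbourhoods of the unit and their left translates\<close>

definition unit_nhd :: "'a set \<Rightarrow> bool" where
  "unit_nhd V \<longleftrightarrow> openin T V \<and> \<one> \<in> V"

lemma unit_nhd_subset: "unit_nhd V \<Longrightarrow> V \<subseteq> carrier S"
  unfolding unit_nhd_def using openin_subset topspace_eq by metis

lemma unit_nhd_closed: "unit_nhd V \<Longrightarrow> v \<in> V \<Longrightarrow> v \<in> carrier S"
  using unit_nhd_subset by blast

lemma unit_nhd_carrier: "unit_nhd (carrier S)"
  unfolding unit_nhd_def using topspace_eq openin_topspace[of T] by simp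

lemma unit_nhd_Int: "unit_nhd V \<Longrightarrow> unit_nhd W \<Longrightarrow> unit_nhd (V \<inter> W)"
  unfolding unit_nhd_def by blast

lemma unit_nhd_Inter:
  assumes "finite I" and "\<And>i. i \<in> I \<Longrightarrow> unit_nhd (V i)"
  shows "\<exists>W. unit_nhd W \<and> (\<forall>i\<in>I. W \<subseteq> V i)"
  using assms
proof (induction I rule: finite_induct)
  case empty
  then show ?case using unit_nhd_carrier by blast
next
  case (insert i I)
  then obtain W where W: "unit_nhd W" "\<forall>j\<in>I. W \<subseteq> V j" by auto
  have "unit_nhd (W \<inter> V i)" using W insert.prems unit_nhd_Int by auto
  with W show ?case by (intro exI[of _ "W \<inter> V i"]) auto
qed

lemma l_coset_mem: "y \<in> a <#\<^bsub>S\<^esub> V \<longleftrightarrow> (\<exists>v\<in>V. y = a \<otimes> v)"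
  unfolding l_coset_def by blast

lemma open_l_coset: "a \<in> carrier S \<Longrightarrow> openin T U \<Longrightarrow> openin T (a <#\<^bsub>S\<^esub> U)"
  using shifts unfolding open_shifts_def by blast

lemma mem_l_coset_nhd: "a \<in> carrier S \<Longrightarrow> unit_nhd V \<Longrightarrow> a \<in> a <#\<^bsub>S\<^esub> V"
  unfolding unit_nhd_def l_coset_mem by force

lemma open_mult:
  assumes "openin T U" "a \<in> carrier S" "b \<in> carrier S" "a \<otimes> b \<in> U"
  obtains A B where "openin T A" "openin T B" "a \<in> A" "b \<in> B"
    "\<And>x y. x \<in> A \<Longrightarrow> y \<in> B \<Longrightarrow> x \<otimes> y \<in> U"
proof -
  let ?P = "{z \<in> topspace (prod_topology T T). (case z of (x, y) \<Rightarrow> x \<otimes> y) \<in> U}"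
  have "openin (prod_topology T T) ?P"
    using openin_continuous_map_preimage[OF continuous_mult assms(1)] .
  moreover have "(a, b) \<in> ?P"
    using assms topspace_eq by simp
  ultimately obtain A B where "openin T A" "openin T B" "a \<in> A" "b \<in> B" "A \<times> B \<subseteq> ?P"
    unfolding openin_prod_topology_alt by meson
  then show ?thesis by (intro that[of A B]) auto
qed

lemma unit_nhd_square:
  assumes "unit_nhd V"
  obtains W where "unit_nhd W" "\<And>x y. x \<in> W \<Longrightarrow> y \<in> W \<Longrightarrow> x \<otimes> y \<in> V"
proof -
  obtain A B where "openin T A" "openin T B" "\<one> \<in> A" "\<one> \<in> B"
    "\<And>x y. x \<in> A \<Longrightarrow> y \<in> B \<Longrightarrow> x \<otimes> y \<in> V"
    using open_mult[OF _ one_closed one_closed, of V] assms unfolding unit_nhd_def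
    by (metis one_closed r_one)
  then show ?thesis
    by (intro that[of "A \<inter> B"]) (auto simp: unit_nhd_def)
qed

text \<open>Applying the square version twice suffices. The final counting uses up four small
  factors: two describe a fattened translate, the other two come from comparing it with points of a
  separated set.\<close>

lemma unit_nhd_fourth_power:
  assumes "unit_nhd V"
  obtains W where "unit_nhd W"
    "\<And>a b c d. a \<in> W \<Longrightarrow> b \<in> W \<Longrightarrow> c \<in> W \<Longrightarrow> d \<in> W \<Longrightarrow> a \<otimes> b \<otimes> (c \<otimes> d) \<in> V"
proof -
  obtain U where U: "unit_nhd U" "\<And>x y. x \<in> U \<Longrightarrow> y \<in> U \<Longrightarrow> x \<otimes> y \<in> V"
    using unit_nhd_square[OF assms] by blast
  obtain W where "unit_nhd W" "\<And>x y. x \<in> W \<Longrightarrow> y \<in> W \<Longrightarrow> x \<otimes> y \<in> U"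
    using unit_nhd_square[OF U(1)] by blast
  with U show ?thesis by (intro that[of W]) auto
qed

lemma nhd_in_open:
  assumes "openin T U" "x \<in> U"
  obtains V where "unit_nhd V" "\<And>v. v \<in> V \<Longrightarrow> x \<otimes> v \<in> U"
proof -
  have x: "x \<in> carrier S" using assms openin_subset topspace_eq by blast
  obtain A B where "openin T B" "x \<in> A" "\<one> \<in> B"
    "\<And>x y. x \<in> A \<Longrightarrow> y \<in> B \<Longrightarrow> x \<otimes> y \<in> U"
    using open_mult[OF assms(1) x one_closed] assms(2) x r_one by metis
  then show ?thesis by (intro that[of B]) (auto simp: unit_nhd_def)
qed

text \<open>The set \<open>yV\<close> is open by open shifts and contains
  \<open>\<one> \<otimes> y\<close>, so continuity of multiplication keeps \<open>xy\<close> in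
  \<open>yV\<close> for \<open>x\<close> near the unit. In a group, \<open>v\<close> would be the
  conjugate of \<open>x\<close> by \<open>y\<close>.\<close>

lemma nhd_swap:
  assumes "unit_nhd V" "y \<in> carrier S"
  obtains G where "unit_nhd G" "\<And>x. x \<in> G \<Longrightarrow> \<exists>v\<in>V. x \<otimes> y = y \<otimes> v"
proof -
  have "openin T (y <#\<^bsub>S\<^esub> V)" using assms open_l_coset unit_nhd_def by blast
  moreover have "\<one> \<otimes> y \<in> y <#\<^bsub>S\<^esub> V" using mem_l_coset_nhd assms by simp
  ultimately obtain A B where "openin T A" "openin T B" "\<one> \<in> A" "y \<in> B"
    "\<And>x z. x \<in> A \<Longrightarrow> z \<in> B \<Longrightarrow> x \<otimes> z \<in> y <#\<^bsub>S\<^esub> V"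
    by (rule open_mult[OF _ one_closed assms(2)]) blast
  then show ?thesis by (intro that[of A]) (auto simp: unit_nhd_def l_coset_mem)
qed

text \<open>The translates \<open>aV\<close> are open by open shifts, and each \<open>a\<close> lies
  in its own \<open>aV\<close>, so compactness applies. The size of such a cover plays the part of
  the inverse of a Haar measure of \<open>V\<close>.\<close>

lemma finite_translate_cover:
  assumes "unit_nhd V"
  obtains F where "finite F" "F \<subseteq> carrier S" "carrier S \<subseteq> (\<Union>f\<in>F. f <#\<^bsub>S\<^esub> V)"
proof -
  let ?C = "(\<lambda>a. a <#\<^bsub>S\<^esub> V) ` carrier S"
  have "compactin T (carrier S)" using compact topspace_eq unfolding compact_space_def by simp
  moreover have "\<forall>U\<in>?C. openin T U" using open_l_coset assms unit_nhd_def by blast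
  moreover have "carrier S \<subseteq> \<Union>?C" using mem_l_coset_nhd assms by blast
  ultimately obtain \<F> where "finite \<F>" "\<F> \<subseteq> ?C" "carrier S \<subseteq> \<Union>\<F>"
    unfolding compactin_def by meson
  then obtain F where "F \<subseteq> carrier S" "finite F" "\<F> = (\<lambda>a. a <#\<^bsub>S\<^esub> V) ` F"
    using finite_subset_image by meson
  then show ?thesis using \<open>carrier S \<subseteq> \<Union>\<F>\<close> by (intro that[of F]) auto
qed

section \<open>Closed subsemigroups and powers close to the unit\<close>

lemma closure_mult_closed:
  assumes A: "A \<subseteq> carrier S" "\<And>x y. x \<in> A \<Longrightarrow> y \<in> A \<Longrightarrow> x \<otimes> y \<in> A"
    and x: "x \<in> T closure_of A" and y: "y \<in> T closure_of A"
  shows "x \<otimes> y \<in> T closure_of A"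
proof -
  have c: "x \<in> carrier S" "y \<in> carrier S"
    using x y topspace_eq by (auto simp: in_closure_of)
  have "\<exists>z. z \<in> A \<and> z \<in> U" if U: "x \<otimes> y \<in> U" "openin T U" for U
  proof -
    obtain B C where B: "openin T B" "openin T C" "x \<in> B" "y \<in> C"
      "\<And>x y. x \<in> B \<Longrightarrow> y \<in> C \<Longrightarrow> x \<otimes> y \<in> U"
      using open_mult[OF U(2) c U(1)] by blast
    then obtain a b where "a \<in> A" "a \<in> B" "b \<in> A" "b \<in> C"
      using x y unfolding in_closure_of by meson
    then show ?thesis using B A by blast
  qed
  then show ?thesis using c topspace_eq by (auto simp: in_closure_of)
qed

text \<open>In a minimal closed subsemigroup \<open>M\<close>, the closure of \<open>xM\<close> is all of \<open>M\<close>, so the neighbourhood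
  \<open>xV\<close> of \<open>x\<close> meets \<open>xM\<close>, and cancelling \<open>x\<close> shows that \<open>V\<close> meets \<open>M\<close>. Zorn's lemma is applied
  to the complements.\<close>

lemma one_mem_closed_subsemigroup:
  assumes K: "closedin T K" "K \<noteq> {}" "\<And>x y. x \<in> K \<Longrightarrow> y \<in> K \<Longrightarrow> x \<otimes> y \<in> K"
  shows "\<one> \<in> K"
proof -
  have Kc: "K \<subseteq> carrier S" using K(1) closedin_subset topspace_eq by metis
  \<comment> \<open>These are the complements of the nonempty closed subsemigroups inside
    \<open>K\<close>; the clause \<open>\<not> carrier S \<subseteq> U\<close> encodes nonemptiness.
    A maximal member gives a minimal subsemigroup.\<close>
  define \<A> where "\<A> = {U. openin T U \<and> carrier S - K \<subseteq> U \<and> \<not> carrier S \<subseteq> U \<and>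
    (\<forall>x\<in>carrier S - U. \<forall>y\<in>carrier S - U. x \<otimes> y \<notin> U)}"
  have "\<exists>M\<in>\<A>. \<forall>X\<in>\<A>. M \<subseteq> X \<longrightarrow> X = M"
  proof (rule subset_Zorn_nonempty)
    have "openin T (carrier S - K)" using K(1) topspace_eq by (metis closedin_def)
    then have "carrier S - K \<in> \<A>" unfolding \<A>_def using K Kc by auto
    then show "\<A> \<noteq> {}" by blast
    fix \<C> assume "\<C> \<noteq> {}" and ch: "subset.chain \<A> \<C>"
    have sub: "\<C> \<subseteq> \<A>" using ch by (simp add: subset.chain_def)
    have op: "openin T U" if "U \<in> \<C>" for U using sub that \<A>_def by blast
    \<comment> \<open>A finite subcover taken from a chain has its union among its members, so a
      single member of the chain would already contain the whole carrier.\<close>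
    have "\<not> carrier S \<subseteq> \<Union>\<C>"
    proof
      assume "carrier S \<subseteq> \<Union>\<C>"
      moreover have "compactin T (carrier S)"
        using compact topspace_eq unfolding compact_space_def by simp
      ultimately obtain \<F> where F: "finite \<F>" "\<F> \<subseteq> \<C>" "carrier S \<subseteq> \<Union>\<F>"
        using op unfolding compactin_def by meson
      have "\<F> \<noteq> {}" using F(3) by auto
      moreover have "subset.chain \<A> \<F>" using F(2) ch unfolding subset_chain_def by blast
      ultimately have "\<Union>\<F> \<in> \<F>" using F(1) Union_in_chain by blast
      then show False using F sub \<A>_def by blast
    qed
    moreover have "openin T (\<Union>\<C>)" using op by blast
    moreover have "carrier S - K \<subseteq> \<Union>\<C>" using \<open>\<C> \<noteq> {}\<close> sub \<A>_def by blast
    moreover have "x \<otimes> y \<notin> \<Union>\<C>" if "x \<in> carrier S - \<Union>\<C>" "y \<in> carrier S - \<Union>\<C>" for x y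
    proof
      assume "x \<otimes> y \<in> \<Union>\<C>"
      then obtain U where "U \<in> \<C>" "x \<otimes> y \<in> U" by blast
      then show False using that sub \<A>_def by blast
    qed
    ultimately show "\<Union>\<C> \<in> \<A>" unfolding \<A>_def by blast
  qed
  then obtain U where U: "U \<in> \<A>" and max: "\<And>X. X \<in> \<A> \<Longrightarrow> U \<subseteq> X \<Longrightarrow> X = U" by blast
  define M where "M = carrier S - U"
  have op: "openin T U" using U \<A>_def by blast
  have Mc: "M \<subseteq> carrier S" and MK: "M \<subseteq> K" using U unfolding M_def \<A>_def by auto
  have Ms: "x \<otimes> y \<in> M" if "x \<in> M" "y \<in> M" for x y
    using U that unfolding M_def \<A>_def by auto
  have Mcl: "closedin T M" using op topspace_eq unfolding M_def by (metis closedin_diff closedin_topspace)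
  obtain x where x: "x \<in> M" using U unfolding M_def \<A>_def by auto
  define N where "N = T closure_of (x <#\<^bsub>S\<^esub> M)"
  have xM: "x <#\<^bsub>S\<^esub> M \<subseteq> M" using Ms x by (auto simp: l_coset_mem)
  have NM: "N \<subseteq> M" unfolding N_def using closure_of_minimal[OF xM Mcl] .
  \<comment> \<open>\<open>xM\<close> is a right ideal of \<open>M\<close>: the second factor is
    itself in \<open>M\<close>, so it can be absorbed into the \<open>M\<close> part of the
    first.\<close>
  have xMs: "a \<otimes> b \<in> x <#\<^bsub>S\<^esub> M" if ab: "a \<in> x <#\<^bsub>S\<^esub> M" "b \<in> x <#\<^bsub>S\<^esub> M" for a b
  proof -
    obtain u where u: "u \<in> M" "a = x \<otimes> u" using ab by (auto simp: l_coset_mem)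
    have b: "b \<in> M" using ab xM by blast
    have "a \<otimes> b = x \<otimes> (u \<otimes> b)" using u b x Mc by (simp add: m_assoc subset_iff)
    then show ?thesis using Ms u b by (auto simp: l_coset_mem)
  qed
  have Ns: "a \<otimes> b \<in> N" if "a \<in> N" "b \<in> N" for a b
    using closure_mult_closed[of "x <#\<^bsub>S\<^esub> M" a b] xMs xM Mc that unfolding N_def by blast
  \<comment> \<open>This point witnesses that \<open>N\<close> is nonempty, so that minimality of
    \<open>M\<close> can be applied to \<open>N\<close>.\<close>
  have xx: "x \<otimes> x \<in> N"
    unfolding N_def
  proof (rule subsetD[OF closure_of_subset])
    show "x <#\<^bsub>S\<^esub> M \<subseteq> topspace T" using xM Mc topspace_eq by auto
    show "x \<otimes> x \<in> x <#\<^bsub>S\<^esub> M" using x by (auto simp: l_coset_mem)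
  qed
  have "carrier S - N \<in> \<A>"
  proof -
    have "openin T (carrier S - N)"
      unfolding N_def using topspace_eq by (metis closedin_closure_of closedin_def)
    then show ?thesis unfolding \<A>_def using NM MK Mc xx Ns by auto
  qed
  then have "carrier S - N = U" using max[of "carrier S - N"] NM unfolding M_def
    using op openin_subset topspace_eq by blast
  then have "N = M" using NM Mc unfolding M_def by blast
  then have xN: "x \<in> T closure_of (x <#\<^bsub>S\<^esub> M)" using x N_def by simp
  have xc: "x \<in> carrier S" using x Mc by blast
  have "\<exists>v. v \<in> M \<and> v \<in> V" if V: "\<one> \<in> V" "openin T V" for V
  proof -
    have n: "unit_nhd V" using V unit_nhd_def by simp
    then obtain y where "y \<in> x <#\<^bsub>S\<^esub> M" "y \<in> x <#\<^bsub>S\<^esub> V"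
      using xN open_l_coset[OF xc V(2)] mem_l_coset_nhd[OF xc n] unfolding in_closure_of by meson
    then obtain m v where "m \<in> M" "v \<in> V" "x \<otimes> m = x \<otimes> v" by (auto simp: l_coset_mem)
    then show ?thesis using l_cancel xc Mc unit_nhd_closed[OF n] by blast
  qed
  then have "\<one> \<in> T closure_of M" by (auto simp: in_closure_of topspace_eq)
  then show ?thesis using MK Mcl closure_of_closedin by blast
qed

text \<open>The closure of the set of positive powers of \<open>a\<close> is a closed subsemigroup
  and hence contains the unit. The exponent is a successor because the zeroth power is the unit
  anyway, and because \<open>a [^] k\<close> can then serve as an approximate inverse of
  \<open>a\<close>.\<close>

lemma power_in_nhd:
  assumes "unit_nhd V" "a \<in> carrier S"
  obtains k :: nat where "a [^] Suc k \<in> V"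
proof -
  let ?P = "range (\<lambda>k::nat. a [^] Suc k)"
  have Pc: "?P \<subseteq> carrier S" using assms(2) by auto
  have mul: "a [^] Suc k \<otimes> a [^] Suc l = a [^] Suc (Suc (k + l))" for k l :: nat
    using nat_pow_mult[OF assms(2), of "Suc k" "Suc l"] by simp
  have "\<one> \<in> T closure_of ?P"
  proof (rule one_mem_closed_subsemigroup)
    show "T closure_of ?P \<noteq> {}"
      using closure_of_subset[of ?P T] Pc topspace_eq by auto
    show "x \<otimes> y \<in> T closure_of ?P" if "x \<in> T closure_of ?P" "y \<in> T closure_of ?P" for x y
    proof (rule closure_mult_closed[OF Pc _ that])
      fix x y assume "x \<in> ?P" "y \<in> ?P"
      then obtain k l :: nat where "x = a [^] Suc k" "y = a [^] Suc l" by blast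
      then show "x \<otimes> y \<in> ?P" using mul by blast
    qed
  qed simp
  then obtain k :: nat where "a [^] Suc k \<in> V"
    using assms(1) unfolding unit_nhd_def in_closure_of by blast
  then show ?thesis by (rule that)
qed

section \<open>Translates by points close to the unit meet\<close>

text \<open>Finitely many of the sets \<open>K W\<close> all contain \<open>K V\<close> for a common
  smaller neighbourhood \<open>V\<close>, by monotonicity. Their closures thus have the finite
  intersection property, and compactness gives a point \<open>p\<close> common to all of
  them.\<close>

lemma cluster_point:
  assumes ne: "\<And>W. unit_nhd W \<Longrightarrow> K W \<noteq> {}"
    and Kc: "\<And>W. K W \<subseteq> carrier S"
    and mono: "\<And>V W. V \<subseteq> W \<Longrightarrow> K V \<subseteq> K W"
  shows "\<exists>p\<in>carrier S. \<forall>N W. openin T N \<longrightarrow> p \<in> N \<longrightarrow> unit_nhd W \<longrightarrow> (\<exists>q\<in>N. q \<in> K W)"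
proof -
  let ?U = "(\<lambda>W. T closure_of (K W)) ` Collect unit_nhd"
  have "\<Inter>?U \<noteq> {}"
  proof -
    have "\<Inter>\<F> \<noteq> {}" if F: "finite \<F>" "\<F> \<subseteq> ?U" for \<F>
    proof -
      obtain \<W> where W: "\<W> \<subseteq> Collect unit_nhd" "finite \<W>" "\<F> = (\<lambda>W. T closure_of (K W)) ` \<W>"
        using F finite_subset_image by meson
      obtain V where V: "unit_nhd V" "\<forall>W\<in>\<W>. V \<subseteq> W"
        using unit_nhd_Inter[of \<W> "\<lambda>W. W"] W by blast
      obtain q where q: "q \<in> K V" using ne V by blast
      have "q \<in> T closure_of (K W)" if "W \<in> \<W>" for W
        using closure_of_subset[of "K W" T] Kc topspace_eq mono[of V W] V q that by blast
      then show ?thesis using W by blast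
    qed
    then show ?thesis using compact unfolding compact_space_fip by auto
  qed
  then obtain p where p: "\<And>W. unit_nhd W \<Longrightarrow> p \<in> T closure_of (K W)" by blast
  show ?thesis
  proof (rule bexI[of _ p], intro allI impI)
    show "p \<in> carrier S" using p[OF unit_nhd_carrier] topspace_eq by (simp add: in_closure_of)
    show "\<exists>q\<in>N. q \<in> K W" if "openin T N" "p \<in> N" "unit_nhd W" for N W
      using p[OF that(3)] that(1,2) unfolding in_closure_of by blast
  qed
qed

text \<open>If \<open>x\<^sup>k\<^sup>+\<^sup>1\<close> is close enough to the unit then \<open>x (x\<^sup>k y) = y v\<close> with \<open>v\<close> small. The factor
  \<open>x\<^sup>k y\<close> need not be small, but by compactness it clusters at a point \<open>p\<close> when \<open>x\<close>, \<open>y\<close>, \<open>v\<close> tend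
  to the unit, and \<open>p\<close> cannot be separated from the unit: a small \<open>z\<close> moves \<open>x\<^sup>k y\<close> into \<open>V\<close>.\<close>

lemma translates_meet:
  assumes V: "unit_nhd V"
  obtains W where "unit_nhd W"
    "\<And>x y. x \<in> W \<Longrightarrow> y \<in> W \<Longrightarrow> \<exists>v\<in>V. \<exists>v'\<in>V. x \<otimes> v = y \<otimes> v'"
proof (rule ccontr)
  note obt = that
  assume "\<not> thesis"
  then have neg: "\<exists>x\<in>W. \<exists>y\<in>W. \<forall>v\<in>V. \<forall>v'\<in>V. x \<otimes> v \<noteq> y \<otimes> v'" if "unit_nhd W" for W
    using that obt by blast
  \<comment> \<open>\<open>K W\<close> collects the possible factors \<open>p\<close> with
    \<open>xp = yv\<close> for those pairs \<open>x\<close>, \<open>y\<close> in \<open>W\<close>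
    whose translates of \<open>V\<close> fail to meet; it shrinks with \<open>W\<close>.\<close>
  define K where "K W = {p \<in> carrier S. \<exists>x\<in>carrier S \<inter> W. \<exists>y\<in>carrier S \<inter> W. \<exists>v\<in>carrier S \<inter> W.
    x \<otimes> p = y \<otimes> v \<and> (\<forall>v\<in>V. \<forall>v'\<in>V. x \<otimes> v \<noteq> y \<otimes> v')}" for W
  have "K W \<noteq> {}" if W: "unit_nhd W" for W
  proof -
    obtain x y where xy: "x \<in> W" "y \<in> W" "\<forall>v\<in>V. \<forall>v'\<in>V. x \<otimes> v \<noteq> y \<otimes> v'"
      using neg[OF W] by blast
    have c: "x \<in> carrier S" "y \<in> carrier S" using xy W unit_nhd_closed by auto
    obtain G where G: "unit_nhd G" "\<And>x. x \<in> G \<Longrightarrow> \<exists>v\<in>W. x \<otimes> y = y \<otimes> v"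
      using nhd_swap[OF W c(2)] by blast
    obtain k :: nat where "x [^] Suc k \<in> G" using power_in_nhd[OF G(1) c(1)] by blast
    then obtain v where v: "v \<in> W" "x [^] Suc k \<otimes> y = y \<otimes> v" using G by blast
    have "x \<otimes> (x [^] k \<otimes> y) = y \<otimes> v"
      using v c nat_pow_Suc2[OF c(1), of k] by (simp add: m_assoc[symmetric] del: nat_pow_Suc)
    moreover have "x [^] k \<otimes> y \<in> carrier S" using c by simp
    ultimately have "x [^] k \<otimes> y \<in> K W"
      unfolding K_def using xy c v(1) unit_nhd_closed[OF W] by blast
    then show ?thesis by blast
  qed
  note K_nonempty = this
  have K_carrier: "K W \<subseteq> carrier S" for W unfolding K_def by blast
  have K_mono: "K W \<subseteq> K W'" if "W \<subseteq> W'" for W W'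
    using that unfolding K_def by blast
  obtain p where pc: "p \<in> carrier S" and
    cluster: "\<forall>N W. openin T N \<longrightarrow> p \<in> N \<longrightarrow> unit_nhd W \<longrightarrow> (\<exists>q\<in>N. q \<in> K W)"
    using cluster_point[OF K_nonempty K_carrier K_mono] by (rule bexE)
  note p = pc cluster[rule_format]
  obtain V1 where V1: "unit_nhd V1" "\<And>x y. x \<in> V1 \<Longrightarrow> y \<in> V1 \<Longrightarrow> x \<otimes> y \<in> V"
    using unit_nhd_square[OF V] by blast
  obtain V2 where V2: "unit_nhd V2" "\<And>x y. x \<in> V2 \<Longrightarrow> y \<in> V2 \<Longrightarrow> x \<otimes> y \<in> V1"
    using unit_nhd_square[OF V1(1)] by blast
  note cl = unit_nhd_closed[OF V1(1)]
  \<comment> \<open>For \<open>q\<close> near \<open>p\<close> and small \<open>x\<close>,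
    \<open>y\<close>, \<open>v\<close> with \<open>xq = yv\<close>, the left side lies in
    \<open>pV1\<close> and the right side in \<open>V1\<close>, so these two sets meet.\<close>
  have "\<exists>z\<in>V1. \<exists>z'\<in>V1. p \<otimes> z = z'"
  proof -
    have "openin T (p <#\<^bsub>S\<^esub> V1)" "\<one> \<otimes> p \<in> p <#\<^bsub>S\<^esub> V1"
      using p(1) V1(1) open_l_coset mem_l_coset_nhd by (auto simp: unit_nhd_def)
    then obtain A N where A: "openin T A" "openin T N" "\<one> \<in> A" "p \<in> N"
      "\<And>x q. x \<in> A \<Longrightarrow> q \<in> N \<Longrightarrow> x \<otimes> q \<in> p <#\<^bsub>S\<^esub> V1"
      by (rule open_mult[OF _ one_closed p(1)]) blast
    have "unit_nhd (V2 \<inter> A)" using A V2 by (auto simp: unit_nhd_def)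
    then obtain q where q: "q \<in> N" "q \<in> K (V2 \<inter> A)" using p(2) A by blast
    then obtain x y v where "x \<in> A" "y \<in> V2" "v \<in> V2" "x \<otimes> q = y \<otimes> v"
      unfolding K_def by blast
    then have "y \<otimes> v \<in> p <#\<^bsub>S\<^esub> V1" "y \<otimes> v \<in> V1" using A q V2 by metis+
    then show ?thesis by (auto simp: l_coset_mem)
  qed
  then obtain z where z: "z \<in> V1" "p \<otimes> z \<in> V1" by blast
  \<comment> \<open>The factor \<open>z\<close> was found for \<open>p\<close> and must also work
    for a nearby \<open>q = po'\<close> in some \<open>K V1\<close>. Moving \<open>o'\<close> past
    \<open>z\<close> gives \<open>qz = (pz)v1\<close>, a product of two elements of
    \<open>V1\<close>.\<close>
  obtain G where G: "unit_nhd G" "\<And>x. x \<in> G \<Longrightarrow> \<exists>v\<in>V1. x \<otimes> z = z \<otimes> v"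
    using nhd_swap[OF V1(1) cl[OF z(1)]] by blast
  have "openin T (p <#\<^bsub>S\<^esub> G)" "p \<in> p <#\<^bsub>S\<^esub> G"
    using p(1) G(1) open_l_coset mem_l_coset_nhd by (auto simp: unit_nhd_def)
  then obtain q where q: "q \<in> p <#\<^bsub>S\<^esub> G" "q \<in> K V1" using p(2) V1(1) by blast
  then obtain o' where o': "o' \<in> G" "q = p \<otimes> o'" by (auto simp: l_coset_mem)
  obtain v1 where v1: "v1 \<in> V1" "o' \<otimes> z = z \<otimes> v1" using G o' by blast
  obtain x y v where x: "x \<in> carrier S" "y \<in> carrier S" "v \<in> V1" "x \<otimes> q = y \<otimes> v"
    "\<forall>v\<in>V. \<forall>v'\<in>V. x \<otimes> v \<noteq> y \<otimes> v'"
    using q(2) unfolding K_def by blast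
  have c: "z \<in> carrier S" "v1 \<in> carrier S" "v \<in> carrier S" "o' \<in> carrier S" "q \<in> carrier S"
    using cl z v1 x unit_nhd_closed[OF G(1)] o' p(1) by auto
  have "q \<otimes> z = p \<otimes> (o' \<otimes> z)" using o' c p(1) by (simp add: m_assoc)
  also have "\<dots> = p \<otimes> z \<otimes> v1" using v1 c p(1) by (simp add: m_assoc)
  finally have "q \<otimes> z \<in> V" using V1 z v1 by simp
  moreover have "v \<otimes> z \<in> V" using V1 z x by simp
  moreover have "x \<otimes> (q \<otimes> z) = y \<otimes> (v \<otimes> z)"
    using x c by (metis m_assoc)
  ultimately show False using x(5) by blast
qed

section \<open>Separated sets of maximal size as a counting measure\<close>

text \<open>This is a packing by left translates of \<open>W\<close>. Finiteness is built in because
  \<open>card\<close> is 0 on infinite sets, which would spoil the bounds and the maximality of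
  \<open>card E\<close>.\<close>

definition separated :: "'a set \<Rightarrow> 'a set \<Rightarrow> bool" where
  "separated W E \<longleftrightarrow> finite E \<and> E \<subseteq> carrier S \<and>
     (\<forall>e\<in>E. \<forall>e'\<in>E. e \<noteq> e' \<longrightarrow> disjnt (e <#\<^bsub>S\<^esub> W) (e' <#\<^bsub>S\<^esub> W))"

text \<open>Choose \<open>Y\<close> such that any two points of \<open>Y\<close> have meeting
  translates of \<open>W\<close>, and cover the monoid by finitely many \<open>fY\<close>. Two
  distinct points of a separated set cannot share one \<open>fY\<close>, so the pigeonhole principle
  bounds the size by that of the cover.\<close>

lemma separated_bounded:
  assumes W: "unit_nhd W"
  obtains N where "\<And>E. separated W E \<Longrightarrow> card E \<le> N"
proof -
  obtain Y where Y: "unit_nhd Y"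
    "\<And>x y. x \<in> Y \<Longrightarrow> y \<in> Y \<Longrightarrow> \<exists>v\<in>W. \<exists>v'\<in>W. x \<otimes> v = y \<otimes> v'"
    using translates_meet[OF W] by blast
  obtain F where F: "finite F" "F \<subseteq> carrier S" "carrier S \<subseteq> (\<Union>f\<in>F. f <#\<^bsub>S\<^esub> Y)"
    using finite_translate_cover[OF Y(1)] by blast
  have "card E \<le> card F" if E: "separated W E" for E
  proof -
    have "\<forall>e\<in>E. \<exists>f\<in>F. e \<in> f <#\<^bsub>S\<^esub> Y" using E F unfolding separated_def by blast
    then obtain h where h: "\<And>e. e \<in> E \<Longrightarrow> h e \<in> F \<and> e \<in> h e <#\<^bsub>S\<^esub> Y" by metis
    have "inj_on h E"
    proof (rule inj_onI, rule ccontr)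
      fix e e' assume e: "e \<in> E" "e' \<in> E" "h e = h e'" "e \<noteq> e'"
      obtain y where y: "y \<in> Y" "e = h e \<otimes> y" using h[OF e(1)] l_coset_mem by blast
      obtain y' where y': "y' \<in> Y" "e' = h e \<otimes> y'"
        using h[OF e(2)] l_coset_mem unfolding e(3) by blast
      obtain w w' where w: "w \<in> W" "w' \<in> W" "y \<otimes> w = y' \<otimes> w'" using Y y y' by blast
      have "e \<otimes> w = e' \<otimes> w'"
      proof -
        have c: "h e \<in> carrier S" "y \<in> carrier S" "y' \<in> carrier S" "w \<in> carrier S" "w' \<in> carrier S"
          using y y' w h[OF e(1)] F(2) unit_nhd_closed[OF Y(1)] unit_nhd_closed[OF W] by auto
        have "h e \<otimes> y \<otimes> w = h e \<otimes> y' \<otimes> w'" using c w by (simp add: m_assoc)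
        then show ?thesis using y(2) y'(2) by simp
      qed
      then show False using E e w unfolding separated_def disjnt_iff l_coset_mem by metis
    qed
    then show ?thesis using card_inj_on_le[of h E F] h F(1) by blast
  qed
  then show ?thesis by (rule that)
qed

text \<open>A common point of two shifted translates becomes, after cancelling \<open>y\<close> on
  the left, a common point of the original ones.\<close>

lemma separated_mult:
  assumes "separated W E" "W \<subseteq> carrier S" "y \<in> carrier S"
  shows "separated W ((\<otimes>) y ` E)"
proof -
  have E: "finite E" "E \<subseteq> carrier S" using assms separated_def by auto
  have "disjnt ((y \<otimes> e) <#\<^bsub>S\<^esub> W) ((y \<otimes> e') <#\<^bsub>S\<^esub> W)" if e: "e \<in> E" "e' \<in> E" "y \<otimes> e \<noteq> y \<otimes> e'" for e e'
  proof -
    have d: "disjnt (e <#\<^bsub>S\<^esub> W) (e' <#\<^bsub>S\<^esub> W)" using assms(1) e unfolding separated_def by metis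
    have "False" if w: "w \<in> W" "w' \<in> W" "y \<otimes> e \<otimes> w = y \<otimes> e' \<otimes> w'" for w w'
    proof -
      have c: "e \<in> carrier S" "e' \<in> carrier S" "w \<in> carrier S" "w' \<in> carrier S"
        using E e w assms(2) by auto
      have "y \<otimes> (e \<otimes> w) = y \<otimes> (e' \<otimes> w')" using w c assms(3) by (simp add: m_assoc)
      then have "e \<otimes> w = e' \<otimes> w'" using l_cancel assms(3) c by (meson m_closed)
      then show False using d w unfolding disjnt_iff l_coset_mem by metis
    qed
    then show ?thesis unfolding disjnt_iff l_coset_mem by metis
  qed
  then show ?thesis using E assms(3) unfolding separated_def by auto
qed

text \<open>Otherwise exchanging the points of \<open>E\<close> counted on the right for the translates \<open>y D\<close> would
  give a larger separated set.\<close>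

lemma card_separated_le:
  assumes W: "unit_nhd W" and E: "separated W E"
    and max: "\<And>E'. separated W E' \<Longrightarrow> card E' \<le> card E"
    and y: "y \<in> carrier S"
    and D: "\<And>e. e \<in> D \<Longrightarrow> e \<in> E \<and> y \<otimes> e \<in> A"
    and A: "A \<subseteq> carrier S"
  shows "card D \<le> card {e \<in> E. \<exists>w\<in>W. \<exists>a\<in>A. \<exists>w'\<in>W. e \<otimes> w = a \<otimes> w'}"
proof -
  let ?B = "{e \<in> E. \<exists>w\<in>W. \<exists>a\<in>A. \<exists>w'\<in>W. e \<otimes> w = a \<otimes> w'}"
  let ?Y = "(\<otimes>) y ` D"
  have fE: "finite E" "E \<subseteq> carrier S" using E separated_def by auto
  have DE: "D \<subseteq> E" using D by blast
  then have fD: "finite D" using fE finite_subset by blast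
  have sD: "separated W D" using E DE fD unfolding separated_def by blast
  have sY: "separated W ?Y" using separated_mult[OF sD unit_nhd_subset[OF W] y] .
  \<comment> \<open>Write \<open>b = yd\<close> with \<open>d\<close> in \<open>D\<close>. Since
    \<open>yd\<close> lies in \<open>A\<close>, a common point of \<open>eW\<close> and
    \<open>bW\<close> would put \<open>e\<close> into \<open>?B\<close>.\<close>
  have dis: "disjnt (e <#\<^bsub>S\<^esub> W) (b <#\<^bsub>S\<^esub> W)" if "e \<in> E - ?B" "b \<in> ?Y" for e b
    using that D unfolding disjnt_iff l_coset_mem by blast
  have "separated W ((E - ?B) \<union> ?Y)"
    using E sY dis dis[THEN disjnt_sym] unfolding separated_def by (auto 0 3)
  then have le: "card ((E - ?B) \<union> ?Y) \<le> card E" by (rule max)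
  have "?Y \<inter> (E - ?B) = {}"
  proof -
    \<comment> \<open>Such a \<open>b\<close> would have a translate \<open>bW\<close> disjoint from
      itself, although it contains \<open>b\<close>.\<close>
    have False if "b \<in> ?Y" "b \<in> E - ?B" for b
      using dis[OF that(2,1)] mem_l_coset_nhd[OF _ W, of b] that fE by (auto simp: disjnt_iff)
    then show ?thesis by blast
  qed
  then have "card ((E - ?B) \<union> ?Y) = card (E - ?B) + card ?Y"
    using fE fD by (intro card_Un_disjoint) auto
  moreover have "card ?Y = card D"
  proof (rule card_image, rule inj_onI)
    fix a b assume "a \<in> D" "b \<in> D" "y \<otimes> a = y \<otimes> b"
    then show "a = b" using l_cancel[of y a b] y DE fE by blast
  qed
  moreover have "card (E - ?B) = card E - card ?B" "card ?B \<le> card E"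
    using fE by (auto intro: card_Diff_subset card_mono)
  ultimately show ?thesis using le by linarith
qed

text \<open>Take a separated set \<open>E\<close> of maximal size. Around each \<open>x i\<close> a
  fattened translate catches at least the fraction \<open>1/n\<close> of \<open>E\<close>, and the
  points caught for different indices are distinct, so there are at most \<open>n\<close>
  indices.\<close>

lemma card_disjoint_translates_le:
  fixes x :: "'i \<Rightarrow> 'a" and Q F :: "'i \<Rightarrow> 'a set"
  assumes I: "finite I"
    and x: "\<And>i. i \<in> I \<Longrightarrow> x i \<in> carrier S"
    and Q: "\<And>i. i \<in> I \<Longrightarrow> unit_nhd (Q i)"
    and F: "\<And>i. i \<in> I \<Longrightarrow> finite (F i) \<and> F i \<subseteq> carrier S \<and> card (F i) \<le> n \<and>
      carrier S \<subseteq> (\<Union>f\<in>F i. f <#\<^bsub>S\<^esub> Q i)"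
    and dis: "\<And>i j a b c d a' b' c' d'. \<lbrakk>i \<in> I; j \<in> I; i \<noteq> j; a \<in> Q i; b \<in> Q i; c \<in> Q i; d \<in> Q i;
      a' \<in> Q j; b' \<in> Q j; c' \<in> Q j; d' \<in> Q j\<rbrakk> \<Longrightarrow>
      x i \<otimes> (a \<otimes> b \<otimes> (c \<otimes> d)) \<noteq> x j \<otimes> (a' \<otimes> b' \<otimes> (c' \<otimes> d'))"
  shows "card I \<le> n"
proof -
  obtain Z where Z: "unit_nhd Z" "\<forall>i\<in>I. Z \<subseteq> Q i" using unit_nhd_Inter[of I Q] I Q by blast
  \<comment> \<open>The scale \<open>W\<close> of the separated set is chosen so fine that two
    points of \<open>W\<close> can be made equal by right factors from \<open>Z\<close>, and
    \<open>Z\<close> is small for all indices at once.\<close>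
  obtain W0 where W0: "unit_nhd W0"
    "\<And>x y. x \<in> W0 \<Longrightarrow> y \<in> W0 \<Longrightarrow> \<exists>v\<in>Z. \<exists>v'\<in>Z. x \<otimes> v = y \<otimes> v'"
    using translates_meet[OF Z(1)] by blast
  define W where "W = W0 \<inter> Z"
  have W: "unit_nhd W" unfolding W_def using unit_nhd_Int W0(1) Z(1) by blast
  have meet: "\<exists>v\<in>Z. \<exists>v'\<in>Z. x \<otimes> v = y \<otimes> v'" if "x \<in> W" "y \<in> W" for x y
    using W0(2) that unfolding W_def by blast
  obtain N where N: "\<And>E. separated W E \<Longrightarrow> card E \<le> N" using separated_bounded[OF W] by blast
  have one: "separated W {\<one>}" unfolding separated_def by simp
  obtain E where E: "separated W E" and max: "\<And>E'. separated W E' \<Longrightarrow> card E' \<le> card E"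
    using ex_has_greatest_nat[of "separated W" "{\<one>}" card "Suc N"] one N
    by (metis le_imp_less_Suc)
  have Epos: "card E > 0" using max[OF one] by simp
  have fE: "finite E" "E \<subseteq> carrier S" using E separated_def by auto
  define A where "A i = (\<lambda>(a, b). x i \<otimes> (a \<otimes> b)) ` (Q i \<times> Q i)" for i
  define B where "B i = {e \<in> E. \<exists>w\<in>W. \<exists>a\<in>A i. \<exists>w'\<in>W. e \<otimes> w = a \<otimes> w'}" for i
  have big: "card E \<le> n * card (B i)" if i: "i \<in> I" for i
  proof -
    note cl = unit_nhd_closed[OF Q[OF i]]
    have Ac: "A i \<subseteq> carrier S" unfolding A_def using x[OF i] cl by auto
    have part: "card (E \<inter> (f <#\<^bsub>S\<^esub> Q i)) \<le> card (B i)" if f: "f \<in> F i" for f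
    proof -
      have fc: "f \<in> carrier S" using F[OF i] f by blast
      obtain k :: nat where k: "f [^] Suc k \<in> Q i" using power_in_nhd[OF Q[OF i] fc] by blast
      \<comment> \<open>As \<open>f [^] k\<close> nearly inverts \<open>f\<close>, left
        multiplication by \<open>y\<close> carries all of \<open>fQ\<close> into \<open>xQQ\<close>,
        which is \<open>A i\<close>.\<close>
      define y where "y = x i \<otimes> f [^] k"
      have yc: "y \<in> carrier S" unfolding y_def using x[OF i] fc by simp
      have "y \<otimes> e \<in> A i" if e: "e \<in> f <#\<^bsub>S\<^esub> Q i" for e
      proof -
        obtain q where q: "q \<in> Q i" "e = f \<otimes> q" using e by (auto simp: l_coset_mem)
        have "y \<otimes> e = x i \<otimes> (f [^] Suc k \<otimes> q)"
          unfolding y_def q(2) using x[OF i] fc cl[OF q(1)] by (simp add: m_assoc)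
        then show ?thesis unfolding A_def using k q(1) by force
      qed
      then show ?thesis
        unfolding B_def using card_separated_le[OF W E max yc _ Ac, of "E \<inter> (f <#\<^bsub>S\<^esub> Q i)"] by blast
    qed
    have "E = (\<Union>f\<in>F i. E \<inter> (f <#\<^bsub>S\<^esub> Q i))" using F[OF i] fE by blast
    then have "card E \<le> (\<Sum>f\<in>F i. card (E \<inter> (f <#\<^bsub>S\<^esub> Q i)))"
      using card_UN_le[of "F i" "\<lambda>f. E \<inter> (f <#\<^bsub>S\<^esub> Q i)"] F[OF i] by metis
    also have "\<dots> \<le> card (F i) * card (B i)"
      using sum_bounded_above[of "F i" "\<lambda>f. card (E \<inter> (f <#\<^bsub>S\<^esub> Q i))" "card (B i)"] part by simp
    also have "\<dots> \<le> n * card (B i)" using F[OF i] by simp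
    finally show ?thesis .
  qed
  \<comment> \<open>A common \<open>e\<close> gives \<open>ew\<close> and \<open>ew'\<close> in
    \<open>A i W\<close> and \<open>A j W\<close>. Factors \<open>d\<close>, \<open>d'\<close> with
    \<open>wd = w'd'\<close> make the two products equal, which yields exactly the four-factor
    equation excluded by \<open>dis\<close>.\<close>
  have "B i \<inter> B j = {}" if ij: "i \<in> I" "j \<in> I" "i \<noteq> j" for i j
  proof (rule ccontr)
    assume "B i \<inter> B j \<noteq> {}"
    then obtain e w a b c w' a' b' c' where e: "e \<in> E" "w \<in> W" "w' \<in> W"
      "a \<in> Q i" "b \<in> Q i" "c \<in> W" "e \<otimes> w = x i \<otimes> (a \<otimes> b) \<otimes> c"
      "a' \<in> Q j" "b' \<in> Q j" "c' \<in> W" "e \<otimes> w' = x j \<otimes> (a' \<otimes> b') \<otimes> c'"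
      unfolding B_def A_def by auto
    obtain d d' where d: "d \<in> Z" "d' \<in> Z" "w \<otimes> d = w' \<otimes> d'" using meet e by blast
    have c: "x i \<in> carrier S" "x j \<in> carrier S" "e \<in> carrier S" "w \<in> carrier S" "w' \<in> carrier S"
       "a \<in> carrier S" "b \<in> carrier S" "c \<in> carrier S" "d \<in> carrier S"
       "a' \<in> carrier S" "b' \<in> carrier S" "c' \<in> carrier S" "d' \<in> carrier S"
      using e d x ij fE unit_nhd_closed[OF W] unit_nhd_closed[OF Z(1)]
        unit_nhd_closed[OF Q[OF ij(1)]] unit_nhd_closed[OF Q[OF ij(2)]] by auto
    have "x i \<otimes> (a \<otimes> b \<otimes> (c \<otimes> d)) = e \<otimes> w \<otimes> d" using e(7) c by (simp add: m_assoc)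
    also have "\<dots> = e \<otimes> w' \<otimes> d'" using d c by (simp add: m_assoc)
    also have "\<dots> = x j \<otimes> (a' \<otimes> b' \<otimes> (c' \<otimes> d'))" using e(11) c by (simp add: m_assoc)
    finally have eq: "x i \<otimes> (a \<otimes> b \<otimes> (c \<otimes> d)) = x j \<otimes> (a' \<otimes> b' \<otimes> (c' \<otimes> d'))" .
    have "Z \<subseteq> Q i" "Z \<subseteq> Q j" "W \<subseteq> Z" using Z ij W_def by auto
    then show False using dis[OF ij, of a b c d a' b' c' d'] e d eq by blast
  qed
  then have "card (\<Union>i\<in>I. B i) = (\<Sum>i\<in>I. card (B i))"
    using I fE unfolding B_def by (intro card_UN_disjoint) auto
  moreover have "card (\<Union>i\<in>I. B i) \<le> card E"
    using fE(1) unfolding B_def by (intro card_mono) auto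
  ultimately have s: "(\<Sum>i\<in>I. card (B i)) \<le> card E" by simp
  \<comment> \<open>Summing the lower bounds for \<open>B i\<close> against their disjointness
    inside \<open>E\<close> leaves a positive factor \<open>card E\<close> to cancel.\<close>
  have "card I * card E \<le> (\<Sum>i\<in>I. n * card (B i))"
    using sum_bounded_below[of I "card E" "\<lambda>i. n * card (B i)"] big by simp
  also have "\<dots> \<le> n * card E" using s by (simp add: sum_distrib_left[symmetric])
  finally show ?thesis using Epos by simp
qed

section \<open>From counting translates to countable cellularity\<close>

text \<open>Each member receives a point, a small neighbourhood of the unit and a finite cover by
  its translates. At most \<open>n\<close> members can have a cover of size at most
  \<open>n\<close>, so the family is a countable union of finite sets.\<close>

lemma countable_cellular_family:
  assumes "cellular_family T \<U>"
  shows "countable \<U>"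
proof -
  have op: "\<And>U. U \<in> \<U> \<Longrightarrow> openin T U \<and> U \<noteq> {}" and pd: "pairwise disjnt \<U>"
    using assms unfolding cellular_family_def by auto
  define good where "good U x Q F \<longleftrightarrow> x \<in> carrier S \<and> unit_nhd Q \<and>
      (\<forall>a\<in>Q. \<forall>b\<in>Q. \<forall>c\<in>Q. \<forall>d\<in>Q. x \<otimes> (a \<otimes> b \<otimes> (c \<otimes> d)) \<in> U) \<and>
      finite F \<and> F \<subseteq> carrier S \<and> carrier S \<subseteq> (\<Union>f\<in>F. f <#\<^bsub>S\<^esub> Q)" for U x Q F
  have "\<forall>U\<in>\<U>. \<exists>x Q F. good U x Q F"
  proof
    fix U assume U: "U \<in> \<U>"
    then obtain x where x: "x \<in> U" using op by blast
    obtain V where V: "unit_nhd V" "\<And>v. v \<in> V \<Longrightarrow> x \<otimes> v \<in> U"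
      using nhd_in_open[OF conjunct1[OF op[OF U]] x] by blast
    obtain Q where Q: "unit_nhd Q"
      "\<And>a b c d. a \<in> Q \<Longrightarrow> b \<in> Q \<Longrightarrow> c \<in> Q \<Longrightarrow> d \<in> Q \<Longrightarrow> a \<otimes> b \<otimes> (c \<otimes> d) \<in> V"
      by (rule unit_nhd_fourth_power[OF V(1)]) blast
    obtain F where "finite F" "F \<subseteq> carrier S" "carrier S \<subseteq> (\<Union>f\<in>F. f <#\<^bsub>S\<^esub> Q)"
      using finite_translate_cover[OF Q(1)] by blast
    moreover have "x \<in> carrier S" using x op[OF U] openin_subset topspace_eq by blast
    ultimately have "good U x Q F" unfolding good_def using Q V by auto
    then show "\<exists>x Q F. good U x Q F" by blast
  qed
  then obtain x Q F where "\<And>U. U \<in> \<U> \<Longrightarrow> good U (x U) (Q U) (F U)"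
    by metis
  note xQF = this[unfolded good_def]
  define \<V> where "\<V> n = {U \<in> \<U>. card (F U) \<le> n}" for n
  have "finite (\<V> n)" for n
  proof (rule ccontr)
    assume "infinite (\<V> n)"
    then obtain I where I: "I \<subseteq> \<V> n" "finite I" "card I = Suc n"
      using infinite_arbitrarily_large by blast
    have sub: "I \<subseteq> \<U>" using I \<V>_def by blast
    have "card I \<le> n"
    proof (rule card_disjoint_translates_le[of I x Q F n])
      show "finite (F i) \<and> F i \<subseteq> carrier S \<and> card (F i) \<le> n \<and> carrier S \<subseteq> (\<Union>f\<in>F i. f <#\<^bsub>S\<^esub> Q i)"
        if "i \<in> I" for i using xQF[of i] I that unfolding \<V>_def by blast
    next
      fix i j a b c d a' b' c' d'
      assume ij: "i \<in> I" "j \<in> I" "i \<noteq> j" and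
        q: "a \<in> Q i" "b \<in> Q i" "c \<in> Q i" "d \<in> Q i" "a' \<in> Q j" "b' \<in> Q j" "c' \<in> Q j" "d' \<in> Q j"
      have "disjnt i j" using pd ij sub unfolding pairwise_def by blast
      moreover have "x i \<otimes> (a \<otimes> b \<otimes> (c \<otimes> d)) \<in> i" using xQF[of i] ij sub q by blast
      moreover have "x j \<otimes> (a' \<otimes> b' \<otimes> (c' \<otimes> d')) \<in> j" using xQF[of j] ij sub q by blast
      ultimately show "x i \<otimes> (a \<otimes> b \<otimes> (c \<otimes> d)) \<noteq> x j \<otimes> (a' \<otimes> b' \<otimes> (c' \<otimes> d'))"
        unfolding disjnt_iff by metis
    qed (use xQF sub I in auto)
    then show False using I by simp
  qed
  moreover have "\<U> = (\<Union>n. \<V> n)" unfolding \<V>_def by blast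
  ultimately show ?thesis by (metis countable_UN countable_finite countableI_type)
qed

end

text \<open>The supremum is at most \<open>natLeq\<close> and is therefore absorbed by the infinite
  summand \<open>natLeq\<close> of the cellularity.\<close>

lemma countable_cellularity_if_countable:
  assumes "\<And>\<U>. cellular_family T \<U> \<Longrightarrow> countable \<U>"
  shows "countable_cellularity T"
proof -
  let ?R = "{|\<U>| | \<U>. cellular_family T \<U>} :: ('a set) rel set"
  have "|\<U>| \<le>o natLeq" if "cellular_family T \<U>" for \<U>
    using assms[OF that] countable_card_le_natLeq by blast
  then have le: "card_Sup ?R \<le>o natLeq"
    by (intro card_Sup_least natLeq_Card_order) (auto simp: card_of_Card_order)
  have "card_Sup ?R +c natLeq =o natLeq"
    by (rule csum_absorb2[OF natLeq_Cinfinite le])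
  then show ?thesis unfolding countable_cellularity_def cellularity_def .
qed

theorem theorem4p7:
  fixes S :: "('a, 'b) monoid_scheme" and T :: "'a topology"
  assumes "topological_monoid S T"
    and "monoid_cancel S"
    and "open_shifts S T"
    and "compact_space T"
  shows "countable_cellularity T"
proof -
  interpret topological_monoid S T by fact
  interpret monoid_cancel S by fact
  interpret compact_cancel_monoid S T by unfold_locales fact+
  show ?thesis
    by (intro countable_cellularity_if_countable countable_cellular_family)
qed

end
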